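(* The generating function for the number of spanning trees in the family $\mathcal{P}_3=\{P_n^3 : n\ge 5\}$ is, as a formal power series, $$\sum_{m=0}^{\infty}\tau(P_{m+5}^3)\,t^m=\frac{-16t^4 + 77t^3 - 33t^2 + 39t - 75}{(t - 1)(t^{4} - 4t^{3} - t^{2} - 4t + 1)}.$$
   Context: All graphs are finite and simple. $P_n$ is the path graph on $n$ vertices. For a graph $G$ and $k\ge1$, the $k$-th power $G^k$ has $V(G^k)=V(G)$, and $uv$ is an edge iff the distance between $u$ and $v$ in $G$ is at least $1$ and at most $k$. $\tau(G)$ is the number of labeled spanning trees of $G$ (isomorphic trees with different labels are counted as different). The family is $\mathcal{P}_k=\{P_n^k : k<\operatorname{diam} P_n\}=\{P_n^k : n\ge k+2\}$; the sequence is indexed so that the constant term of the generating function corresponds to the smallest member $n=k+2$. *)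

theory Defs
  imports
    "Graph_Theory.Graph_Theory"
    "HOL-Computational_Algebra.Formal_Power_Series"
begin

text \<open>
  A finite simple graph is a \<open>pair_graph\<close>: a finite, loop-free, symmetric set of arcs, in
  which the edge \<open>uv\<close> is represented by the two arcs \<open>(u, v)\<close> and \<open>(v, u)\<close>.
\<close>

definition path_graph :: "nat \<Rightarrow> nat pair_pre_digraph" where
  "path_graph n = \<lparr> pverts = {1..n},
     parcs = {(u, v). u \<in> {1..n} \<and> v \<in> {1..n} \<and> (v = u + 1 \<or> u = v + 1)} \<rparr>"

text \<open>
  With all arc weights equal to 1, \<open>wf_digraph.\<mu>\<close> is the distance (it is \<open>\<infinity>\<close>
  between different components).
\<close>

definition graph_dist :: "'a pair_pre_digraph \<Rightarrow> 'a \<Rightarrow> 'a \<Rightarrow> ereal" where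
  "graph_dist G u v = wf_digraph.\<mu> (with_proj G) (\<lambda>_. 1) u v"

definition graph_power :: "'a pair_pre_digraph \<Rightarrow> nat \<Rightarrow> 'a pair_pre_digraph" where
  "graph_power G k = \<lparr> pverts = pverts G,
     parcs = {(u, v). u \<in> pverts G \<and> v \<in> pverts G \<and>
       1 \<le> graph_dist G u v \<and> graph_dist G u v \<le> ereal (real k)} \<rparr>"

text \<open>
  The predicates \<open>forest\<close>, \<open>tree\<close> and \<open>spanning_tree\<close> of the library exclude directed
  cycles only, so they do not express the undirected notions: every edge of a symmetric digraph
  already is a directed cycle of length 2. The cycles of an undirected simple graph are the
  directed cycles of length at least 3 of its symmetric digraph.
\<close>

definition undirected_tree :: "'a pair_pre_digraph \<Rightarrow> bool" where
  "undirected_tree T \<longleftrightarrow> pair_graph T \<and> connected (with_proj T) \<and>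
     \<not> (\<exists>p. pre_digraph.cycle (with_proj T) p \<and> 3 \<le> length p)"

definition spanning_trees :: "'a pair_pre_digraph \<Rightarrow> 'a pair_pre_digraph set" where
  "spanning_trees G = {T. undirected_tree T \<and> spanning (with_proj T) (with_proj G)}"

definition num_spanning_trees :: "'a pair_pre_digraph \<Rightarrow> nat" where
  "num_spanning_trees G = card (spanning_trees G)"

lemma pverts_path_graph [simp]: "pverts (path_graph n) = {1..n}"
  by (simp add: path_graph_def)

lemma parcs_path_graph_iff [simp]: "(u, v) \<in> parcs (path_graph n) \<longleftrightarrow>
    u \<in> {1..n} \<and> v \<in> {1..n} \<and> (v = u + 1 \<or> u = v + 1)"
  by (simp add: path_graph_def)

lemma pair_graph_path_graph: "pair_graph (path_graph n)"
proof -
  have "finite (parcs (path_graph n))"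
    by (rule finite_subset[of _ "{1..n} \<times> {1..n}"]) (auto simp: path_graph_def)
  then show ?thesis
    by unfold_locales (auto simp: path_graph_def arcs_ends_def arc_to_ends_def symmetric_def sym_def)
qed

lemma finite_spanning_trees:
  assumes "pair_graph G"
  shows "finite (spanning_trees G)"
proof (rule finite_subset)
  interpret pair_graph G by fact
  show "finite ((\<lambda>A. \<lparr> pverts = pverts G, parcs = A \<rparr>) ` Pow (parcs G))"
    using pair_finite_arcs by simp
  show "spanning_trees G \<subseteq> (\<lambda>A. \<lparr> pverts = pverts G, parcs = A \<rparr>) ` Pow (parcs G)"
  proof
    fix T assume "T \<in> spanning_trees G"
    then have "pverts T = pverts G" "parcs T \<subseteq> parcs G"
      by (auto simp: spanning_trees_def spanning_def subgraph_def)
    then show "T \<in> (\<lambda>A. \<lparr> pverts = pverts G, parcs = A \<rparr>) ` Pow (parcs G)"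
      by (intro image_eqI[of _ _ "parcs T"]) auto
  qed
qed

lemma awalk_length_path_graph:
  assumes "pre_digraph.awalk (with_proj (path_graph n)) u p v"
  shows "\<bar>int u - int v\<bar> \<le> int (length p)"
proof -
  interpret pair_graph "path_graph n" by (rule pair_graph_path_graph)
  show ?thesis
    using assms
  proof (induction p arbitrary: u)
    case Nil
    then show ?case by (simp add: awalk_Nil_iff)
  next
    case (Cons e p)
    then have e: "e \<in> parcs (path_graph n)" "u = fst e" "awalk (snd e) p v"
      by (auto simp: awalk_Cons_iff)
    then have "\<bar>int u - int (snd e)\<bar> \<le> 1"
      by (auto simp: path_graph_def)
    with Cons.IH[OF e(3)] show ?case by simp
  qed
qed

lemma ex_awalk_path_graph:
  assumes "1 \<le> u" "u + d \<le> n"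
  shows "\<exists>p. pre_digraph.awalk (with_proj (path_graph n)) u p (u + d) \<and> length p = d"
    and "\<exists>p. pre_digraph.awalk (with_proj (path_graph n)) (u + d) p u \<and> length p = d"
proof -
  interpret pair_graph "path_graph n" by (rule pair_graph_path_graph)
  show "\<exists>p. awalk u p (u + d) \<and> length p = d"
    using assms
  proof (induction d arbitrary: u)
    case 0
    then show ?case by (intro exI[of _ "[]"]) (simp add: awalk_Nil_iff)
  next
    case (Suc d)
    then obtain p where "awalk (Suc u) p (Suc u + d)" "length p = d"
      by (metis Suc_leD add_Suc_shift le_Suc_eq)
    with Suc.prems show ?case
      by (intro exI[of _ "(u, Suc u) # p"]) (auto simp: awalk_Cons_iff)
  qed
  show "\<exists>p. awalk (u + d) p u \<and> length p = d"
    using assms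
  proof (induction d)
    case 0
    then show ?case by (intro exI[of _ "[]"]) (simp add: awalk_Nil_iff)
  next
    case (Suc d)
    then obtain p where "awalk (u + d) p u" "length p = d" by auto
    with Suc.prems show ?case
      by (intro exI[of _ "(Suc (u + d), u + d) # p"]) (auto simp: awalk_Cons_iff)
  qed
qed

lemma graph_dist_path_graph:
  assumes "u \<in> {1..n}" "v \<in> {1..n}"
  shows "graph_dist (path_graph n) u v = ereal \<bar>real u - real v\<bar>"
proof -
  interpret pair_graph "path_graph n" by (rule pair_graph_path_graph)
  have cost: "awalk_cost (\<lambda>_. 1) p = real (length p)" for p :: "(nat \<times> nat) list"
    by (induction p) auto
  have "\<exists>p. awalk u p v \<and> real (length p) = \<bar>real u - real v\<bar>"
  proof (cases "u \<le> v")
    case True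
    with assms ex_awalk_path_graph(1)[of u "v - u" n] show ?thesis by (auto simp: of_nat_diff)
  next
    case False
    with assms ex_awalk_path_graph(2)[of v "u - v" n] show ?thesis by (auto simp: of_nat_diff)
  qed
  then obtain p where p: "awalk u p v" "real (length p) = \<bar>real u - real v\<bar>" by blast
  have low: "\<bar>real u - real v\<bar> \<le> real (length q)" if "awalk u q v" for q
    using awalk_length_path_graph[OF that] by linarith
  show ?thesis
    unfolding graph_dist_def \<mu>_def
  proof (rule antisym)
    show "(INF p\<in>{p. awalk u p v}. ereal (awalk_cost (\<lambda>_. 1) p)) \<le> ereal \<bar>real u - real v\<bar>"
      using p by (intro INF_lower2[of p]) (simp_all add: cost)
    show "ereal \<bar>real u - real v\<bar> \<le> (INF p\<in>{p. awalk u p v}. ereal (awalk_cost (\<lambda>_. 1) p))"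
      using low by (intro INF_greatest) (simp add: cost)
  qed
qed

lemma parcs_path_graph_power:
  "parcs (graph_power (path_graph n) k) =
     {(u, v). u \<in> {1..n} \<and> v \<in> {1..n} \<and> u \<noteq> v \<and> u \<le> v + k \<and> v \<le> u + k}"
proof -
  have "1 \<le> graph_dist (path_graph n) u v \<and> graph_dist (path_graph n) u v \<le> ereal (real k)
      \<longleftrightarrow> u \<noteq> v \<and> u \<le> v + k \<and> v \<le> u + k" if "u \<in> {1..n}" "v \<in> {1..n}" for u v
    unfolding graph_dist_path_graph[OF that] by (simp add: one_ereal_def) linarith
  then show ?thesis by (auto simp: graph_power_def)
qed

end

theory Submission
  imports Defs
begin

text \<open>
  The spanning trees of the cube of a path are counted with a transfer matrix. In
  \<open>graph_power (path_graph n) 3\<close> the last vertex is adjacent to at most the three vertices before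
  it. Deleting it from a spanning tree leaves a spanning forest in which every tree meets those
  three vertices, and whether a set of edges at a new vertex extends such a forest depends only on how
  its trees partition the three most recent vertices. Counting forests by this partition therefore
  gives a linear recurrence with five states, one for each partition of a three-element set
  (\<open>card_frontier_forests_Suc\<close>, \<open>card_frontier_forests_rec\<close>). The spanning trees are
  the forests in the state with a single block (\<open>num_spanning_trees_eq_card\<close>).

  Eliminating the four other states leaves a recurrence of order five for the number of spanning
  trees (\<open>card_frontier_forests_connected_rec\<close>), whose characteristic polynomial is
  \<open>(t - 1) * (t^4 - 4 t^3 - t^2 - 4 t + 1)\<close>. The product of the generating function with the
  denominator is thus a polynomial of degree at most 4, and the first five values
  75, 336, 1488, 6580, 29085 determine it.

  Forests are represented by symmetric relations all of whose edges are bridges. The lemmas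
  \<open>rtrancl_star_hub\<close> and \<open>forest_rel_star_iff\<close> describe how connectivity and this
  property change when a vertex is added, and \<open>ex_cycle_iff_ex_non_bridge\<close> identifies the property
  with the absence of directed cycles of length at least 3.
\<close>

section \<open>Forests as relations\<close>

definition star :: "'a \<Rightarrow> 'a set \<Rightarrow> ('a \<times> 'a) set" where
  "star w S = {w} \<times> S \<union> S \<times> {w}"

text \<open>
  The condition that every edge is a bridge is acyclicity without any mention of closed walks. It
  speaks of reachability only, so it can be followed through the insertion of a vertex by
  computing reflexive-transitive closures; no cycle has to be cut open or rotated.
\<close>

definition forest_rel :: "('a \<times> 'a) set \<Rightarrow> bool" where
  "forest_rel A \<longleftrightarrow> sym A \<and> (\<forall>u v. (u, v) \<in> A \<longrightarrow> (u, v) \<notin> (A - {(u, v), (v, u)})\<^sup>*)"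

lemma rtrancl_commute: "sym A \<Longrightarrow> (x, y) \<in> A\<^sup>* \<longleftrightarrow> (y, x) \<in> A\<^sup>*"
  by (metis sym_rtrancl symE)

lemma sym_star: "sym (star w S)"
  by (auto simp: sym_def star_def)

text \<open>
  All new connections run through the new vertex \<open>w\<close>. A walk may visit \<open>w\<close>
  several times, but what lies between its first arrival and its last departure can be dropped.
\<close>

lemma rtrancl_star_hub:
  assumes "w \<notin> Field A" "w \<notin> S" "x \<noteq> w"
  shows "(x, w) \<in> (A \<union> star w S)\<^sup>* \<longleftrightarrow> (\<exists>s\<in>S. (x, s) \<in> A\<^sup>*)"
    and "y \<noteq> w \<Longrightarrow> (x, y) \<in> (A \<union> star w S)\<^sup>* \<longleftrightarrow>
      (x, y) \<in> A\<^sup>* \<or> (\<exists>s\<in>S. (x, s) \<in> A\<^sup>*) \<and> (\<exists>s\<in>S. (s, y) \<in> A\<^sup>*)"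
proof -
  let ?B = "A \<union> star w S"
  have mono: "(a, b) \<in> ?B\<^sup>*" if "(a, b) \<in> A\<^sup>*" for a b
    using that rtrancl_mono[of A ?B] by blast
  have hub: "(s, w) \<in> ?B" "(w, s) \<in> ?B" if "s \<in> S" for s
    using that by (auto simp: star_def)
  have only: "if z = w then \<exists>s\<in>S. (x, s) \<in> A\<^sup>*
      else (x, z) \<in> A\<^sup>* \<or> (\<exists>s\<in>S. (x, s) \<in> A\<^sup>*) \<and> (\<exists>s\<in>S. (s, z) \<in> A\<^sup>*)"
    if "(x, z) \<in> ?B\<^sup>*" for z
    using that
  proof (induction rule: rtrancl_induct)
    case base
    show ?case using assms by simp
  next
    case (step y z)
    consider "(y, z) \<in> A" | "y = w" "z \<in> S" | "y \<in> S" "z = w"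
      using step.hyps(2) by (auto simp: star_def)
    then show ?case
    proof cases
      case 1
      then have "y \<noteq> w" "z \<noteq> w" using assms(1) by (auto simp: Field_def)
      with 1 step.IH show ?thesis by (auto intro: rtrancl_into_rtrancl)
    next
      case 2
      with step.IH assms show ?thesis by auto
    next
      case 3
      with step.IH assms(2) show ?thesis by (auto split: if_splits)
    qed
  qed
  have into: "(x, w) \<in> ?B\<^sup>*" if "s \<in> S" "(x, s) \<in> A\<^sup>*" for s
    using mono[OF that(2)] hub(1)[OF that(1)] by (rule rtrancl_into_rtrancl)
  have out_of: "(w, y) \<in> ?B\<^sup>*" if "s \<in> S" "(s, y) \<in> A\<^sup>*" for s y
    using hub(2)[OF that(1)] mono[OF that(2)] by (rule converse_rtrancl_into_rtrancl)
  show "(x, w) \<in> ?B\<^sup>* \<longleftrightarrow> (\<exists>s\<in>S. (x, s) \<in> A\<^sup>*)"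
    using only[of w] into by auto
  show "(x, y) \<in> ?B\<^sup>* \<longleftrightarrow>
      (x, y) \<in> A\<^sup>* \<or> (\<exists>s\<in>S. (x, s) \<in> A\<^sup>*) \<and> (\<exists>s\<in>S. (s, y) \<in> A\<^sup>*)" if "y \<noteq> w"
    using only[of y] that mono[of x y] into out_of[of _ y] rtrancl_trans[of x w ?B y] by auto
qed

text \<open>
  The arcs at \<open>w\<close> are bridges iff the neighbours of \<open>w\<close> lie in different trees:
  deleting \<open>sw\<close> leaves \<open>s\<close> connected to \<open>w\<close> only through another neighbour
  in its own tree. In that case no old arc \<open>uv\<close> stops being a bridge, because the detour
  around it through \<open>w\<close> would leave and re-enter the tree that contains \<open>u\<close> and
  \<open>v\<close> at two different neighbours of \<open>w\<close>.
\<close>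

lemma forest_rel_star_iff:
  assumes "sym A" "w \<notin> Field A" "w \<notin> S"
  shows "forest_rel (A \<union> star w S) \<longleftrightarrow>
    forest_rel A \<and> (\<forall>s\<in>S. \<forall>s'\<in>S. (s, s') \<in> A\<^sup>* \<longrightarrow> s = s')"
proof -
  let ?B = "A \<union> star w S"
  have symB: "sym ?B" using assms(1) sym_star by (rule sym_Un)
  have hub_arc: "(s, w) \<in> (?B - {(s, w), (w, s)})\<^sup>* \<longleftrightarrow> (\<exists>s'\<in>S - {s}. (s, s') \<in> A\<^sup>*)" if "s \<in> S" for s
  proof -
    have "?B - {(s, w), (w, s)} = A \<union> star w (S - {s})"
      using assms(2,3) that by (auto simp: star_def Field_def)
    with assms(2,3) that show ?thesis by (subst rtrancl_star_hub(1)[symmetric]) auto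
  qed
  have old_arc: "(u, v) \<in> (?B - {(u, v), (v, u)})\<^sup>* \<longleftrightarrow> (u, v) \<in> (A - {(u, v), (v, u)})\<^sup>* \<or>
      (\<exists>s\<in>S. (u, s) \<in> (A - {(u, v), (v, u)})\<^sup>*) \<and> (\<exists>s\<in>S. (s, v) \<in> (A - {(u, v), (v, u)})\<^sup>*)"
    if "(u, v) \<in> A" for u v
  proof -
    let ?A = "A - {(u, v), (v, u)}"
    have ne: "u \<noteq> w" "v \<noteq> w" using that assms(2) by (auto simp: Field_def)
    then have "?B - {(u, v), (v, u)} = ?A \<union> star w S"
      by (auto simp: star_def)
    moreover have "w \<notin> Field ?A" using assms(2) by (auto simp: Field_def)
    ultimately show ?thesis using rtrancl_star_hub(2)[of w ?A S u v] ne assms(3) by simp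
  qed
  show ?thesis
  proof
    assume B: "forest_rel ?B"
    have "(s, s') \<notin> A\<^sup>*" if "s \<in> S" "s' \<in> S" "s \<noteq> s'" for s s'
    proof -
      have "(s, w) \<in> ?B" using that by (auto simp: star_def)
      with B have "(s, w) \<notin> (?B - {(s, w), (w, s)})\<^sup>*" by (auto simp: forest_rel_def)
      with hub_arc[OF that(1)] that show ?thesis by blast
    qed
    moreover have "forest_rel A"
      using B old_arc assms(1) by (auto simp: forest_rel_def)
    ultimately show "forest_rel A \<and> (\<forall>s\<in>S. \<forall>s'\<in>S. (s, s') \<in> A\<^sup>* \<longrightarrow> s = s')" by blast
  next
    assume A: "forest_rel A \<and> (\<forall>s\<in>S. \<forall>s'\<in>S. (s, s') \<in> A\<^sup>* \<longrightarrow> s = s')"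
    have "(u, v) \<notin> (?B - {(u, v), (v, u)})\<^sup>*" if uv: "(u, v) \<in> ?B" for u v
    proof -
      consider (old) "(u, v) \<in> A" | (hub) s where "s \<in> S" "(u, v) = (s, w) \<or> (u, v) = (w, s)"
        using uv by (auto simp: star_def)
      then show ?thesis
      proof cases
        case old
        let ?A = "A - {(u, v), (v, u)}"
        have no: "(u, v) \<notin> ?A\<^sup>*" using A old by (auto simp: forest_rel_def)
        have sub: "?A\<^sup>* \<subseteq> A\<^sup>*" by (rule rtrancl_mono) auto
        have False if "s \<in> S" "s' \<in> S" "(u, s) \<in> ?A\<^sup>*" "(s', v) \<in> ?A\<^sup>*" for s s'
        proof -
          \<comment> \<open>both ends of the detour through \<open>w\<close> lie in the tree of \<open>A\<close> that contains \<open>uv\<close>\<close>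
          have "(s, u) \<in> A\<^sup>*" "(v, s') \<in> A\<^sup>*"
            using that sub rtrancl_commute[OF assms(1)] by blast+
          with old have "(s, s') \<in> A\<^sup>*" by (meson r_into_rtrancl rtrancl_trans)
          with A that have "s = s'" by blast
          with that no show False by (meson rtrancl_trans)
        qed
        with no old_arc[OF old] show ?thesis by blast
      next
        case hub
        have "sym (?B - {(u, v), (v, u)})" using symB by (auto simp: sym_def)
        note com = rtrancl_commute[OF this, of u v]
        have "(s, w) \<notin> (?B - {(s, w), (w, s)})\<^sup>*" using hub_arc[OF hub(1)] A hub(1) by blast
        moreover have "{(s, w), (w, s)} = {(u, v), (v, u)}" using hub(2) by auto
        ultimately show ?thesis using hub(2) com by auto
      qed
    qed
    with symB show "forest_rel ?B" by (auto simp: forest_rel_def)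
  qed
qed

section \<open>Trees and cycles of symmetric digraphs\<close>

context pair_graph begin

lemma awalk_imp_rtrancl: "awalk u p v \<Longrightarrow> (u, v) \<in> (set p)\<^sup>*"
proof (induction p arbitrary: u)
  case Nil
  then show ?case by (simp add: awalk_Nil_iff)
next
  case (Cons e p)
  then have "u = fst e" "(snd e, v) \<in> (set p)\<^sup>*" by (auto simp: awalk_Cons_iff)
  moreover have "(set p)\<^sup>* \<subseteq> (set (e # p))\<^sup>*" by (rule rtrancl_mono) auto
  ultimately show ?case
    by (metis converse_rtrancl_into_rtrancl list.set_intros(1) prod.collapse subsetD)
qed

lemma rtrancl_imp_apath:
  assumes "(u, v) \<in> B\<^sup>*" "B \<subseteq> parcs G" "u \<in> pverts G"
  shows "\<exists>p. apath u p v \<and> set p \<subseteq> B"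
proof -
  have "\<exists>p. awalk u p v \<and> set p \<subseteq> B"
    using assms(1)
  proof (induction rule: rtrancl_induct)
    case base
    then show ?case using assms(3) by (intro exI[of _ "[]"]) (simp add: awalk_Nil_iff)
  next
    case (step y z)
    then obtain p where p: "awalk u p y" "set p \<subseteq> B" by blast
    have "awalk y [(y, z)] z"
      using step.hyps(2) assms(2) by (auto simp: awalk_simps dest: in_arcsD2)
    with p step.hyps(2) show ?case
      by (intro exI[of _ "p @ [(y, z)]"]) (auto intro: awalk_appendI)
  qed
  then obtain p where "awalk u p v" "set p \<subseteq> B" by blast
  then show ?thesis
    using apath_awalk_to_apath awalk_to_apath_subset by blast
qed

text \<open>
  Removing the first arc \<open>(u, v)\<close> of a cycle leaves a path from \<open>v\<close> back to
  \<open>u\<close>. It meets \<open>u\<close> and \<open>v\<close> only at its ends, so it avoids \<open>(u, v)\<close>;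
  and it avoids \<open>(v, u)\<close> unless it consists of that arc alone, which is exactly the excluded
  case of a cycle of length 2.
\<close>

lemma ex_cycle_iff_ex_non_bridge:
  "(\<exists>p. cycle p \<and> 3 \<le> length p) \<longleftrightarrow>
    (\<exists>u v. (u, v) \<in> parcs G \<and> (u, v) \<in> (parcs G - {(u, v), (v, u)})\<^sup>*)"
proof
  assume "\<exists>p. cycle p \<and> 3 \<le> length p"
  then obtain p w where p: "awalk w p w" "distinct (tl (awalk_verts w p))" "3 \<le> length p"
    unfolding cycle_def by blast
  then obtain u v x q where pq: "p = (u, v) # (v, x) # q"
    by (cases p; cases "tl p") (auto simp: awalk_Cons_iff)
  from p pq have uv: "(u, v) \<in> parcs G" and w: "w = u" and q: "awalk v ((v, x) # q) u"
    by (auto simp: awalk_Cons_iff)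
  from p(2) pq have v: "v \<notin> set (awalk_verts x q)" and dq: "distinct (awalk_verts x q)" by auto
  have qx: "awalk x q u" using q by (simp add: awalk_Cons_iff)
  have "q \<noteq> []" using p(3) pq by auto
  then have "x \<noteq> u" using apath_nonempty_ends[of x q u] qx dq by (auto simp: apath_def)
  moreover have "u \<noteq> v" using uv no_loops' by blast
  moreover have "(u, v) \<notin> set q" "(v, u) \<notin> set q"
    using v awalk_verts_arc1[of "(v, u)" q x] awalk_verts_arc2[OF qx, of "(u, v)"] by auto
  moreover have "set ((v, x) # q) \<subseteq> parcs G" using q unfolding awalk_def by simp
  ultimately have "set ((v, x) # q) \<subseteq> parcs G - {(u, v), (v, u)}" by auto
  then have "(v, u) \<in> (parcs G - {(u, v), (v, u)})\<^sup>*"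
    using awalk_imp_rtrancl[OF q] rtrancl_mono by blast
  moreover have "sym (parcs G - {(u, v), (v, u)})"
    using arcs_symmetric by (auto simp: sym_def)
  ultimately show "\<exists>u v. (u, v) \<in> parcs G \<and> (u, v) \<in> (parcs G - {(u, v), (v, u)})\<^sup>*"
    using uv rtrancl_commute by metis
next
  assume "\<exists>u v. (u, v) \<in> parcs G \<and> (u, v) \<in> (parcs G - {(u, v), (v, u)})\<^sup>*"
  then obtain u v where uv: "(u, v) \<in> parcs G" "(u, v) \<in> (parcs G - {(u, v), (v, u)})\<^sup>*"
    by blast
  have "sym (parcs G - {(u, v), (v, u)})"
    using arcs_symmetric by (auto simp: sym_def)
  with uv(2) have "(v, u) \<in> (parcs G - {(u, v), (v, u)})\<^sup>*"
    using rtrancl_commute by metis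
  then obtain q where q: "apath v q u" "set q \<subseteq> parcs G - {(u, v), (v, u)}"
    using rtrancl_imp_apath[of v u] uv(1) in_arcsD2 by blast
  have "u \<noteq> v" using uv(1) no_loops' by blast
  then have "q \<noteq> []" using q(1) by (auto simp: apath_Nil_iff)
  moreover have "q \<noteq> [e]" for e
    using q by (cases e) (auto simp: apath_simps)
  ultimately have "2 \<le> length q" by (cases q; cases "tl q") auto
  moreover have "cycle ((u, v) # q)"
    unfolding cycle_def using q(1) uv(1) by (intro exI[of _ u]) (auto simp: awalk_Cons_iff apath_def)
  ultimately show "\<exists>p. cycle p \<and> 3 \<le> length p"
    by (intro exI[of _ "(u, v) # q"]) auto
qed

lemma connected_iff_rtrancl:
  "connected (with_proj G) \<longleftrightarrow>
    pverts G \<noteq> {} \<and> (\<forall>u\<in>pverts G. \<forall>v\<in>pverts G. (u, v) \<in> (parcs G)\<^sup>*)"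
proof -
  have "u \<rightarrow>\<^sup>*\<^bsub>with_proj G\<^esub> v \<longleftrightarrow> (u, v) \<in> (parcs G)\<^sup>*" if "u \<in> pverts G" for u v
  proof
    assume "u \<rightarrow>\<^sup>*\<^bsub>with_proj G\<^esub> v"
    then show "(u, v) \<in> (parcs G)\<^sup>*" using reachable_rtranclI by fastforce
  next
    assume "(u, v) \<in> (parcs G)\<^sup>*"
    then show "u \<rightarrow>\<^sup>*\<^bsub>with_proj G\<^esub> v"
      using rtrancl_imp_apath[of u v "parcs G"] that awalkI_apath reachable_awalkI by blast
  qed
  moreover have "pverts (mk_symmetric (with_proj G)) = pverts G"
    by (simp add: mk_symmetric_def)
  ultimately show ?thesis
    by (simp add: connected_def strongly_connected_def reachable_mk_symmetric_eq[OF sym_arcs])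
qed

lemma undirected_tree_iff:
  "undirected_tree G \<longleftrightarrow> pverts G \<noteq> {} \<and>
    (\<forall>u\<in>pverts G. \<forall>v\<in>pverts G. (u, v) \<in> (parcs G)\<^sup>*) \<and> forest_rel (parcs G)"
proof -
  have "sym (parcs G)" using arcs_symmetric by (auto simp: sym_def)
  then show ?thesis
    unfolding undirected_tree_def connected_iff_rtrancl ex_cycle_iff_ex_non_bridge forest_rel_def
    using pair_graph by blast
qed

end

section \<open>The transfer step for the cube of a path\<close>

text \<open>
  The forests on \<open>{1..n}\<close> that can still grow into a spanning tree: vertices up to
  \<open>n - 3\<close> receive no further edges, so every tree must reach the frontier
  \<open>{n - 2, n - 1, n}\<close>. The state \<open>\<sigma>\<close> records which pairs of frontier vertices lie in the
  same tree, in the order \<open>(n - 2, n - 1)\<close>, \<open>(n - 2, n)\<close>, \<open>(n - 1, n)\<close>.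

  For \<open>n < 3\<close> the truncated subtraction puts the frontier positions without a vertex on the
  number 0, which is isolated. The state remains meaningful there, so that the recurrence can start
  at the empty graph.
\<close>

definition frontier_forests :: "nat \<Rightarrow> bool \<times> bool \<times> bool \<Rightarrow> (nat \<times> nat) set set" where
  "frontier_forests n \<sigma> = {A. A \<subseteq> parcs (graph_power (path_graph n) 3) \<and> forest_rel A \<and>
     (\<forall>v\<in>{1..n}. \<exists>f\<in>{n - 2..n}. (v, f) \<in> A\<^sup>*) \<and>
     \<sigma> = ((n - 2, n - 1) \<in> A\<^sup>*, (n - 2, n) \<in> A\<^sup>*, (n - 1, n) \<in> A\<^sup>*)}"

text \<open>
  The choice \<open>\<xi> = (x, y, z)\<close> tells which of \<open>n - 2\<close>, \<open>n - 1\<close>,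
  \<open>n\<close> become neighbours of the new vertex \<open>n + 1\<close>.
\<close>

fun nbrs :: "nat \<Rightarrow> bool \<times> bool \<times> bool \<Rightarrow> nat set" where
  "nbrs n (x, y, z) = {v. x \<and> v = n - 2 \<or> y \<and> v = n - 1 \<or> z \<and> v = n}"

text \<open>
  Frontier positions that stand for 0 must not be chosen.
\<close>

fun present :: "nat \<Rightarrow> bool \<times> bool \<times> bool \<Rightarrow> bool" where
  "present n (x, y, z) \<longleftrightarrow> (x \<longrightarrow> 3 \<le> n) \<and> (y \<longrightarrow> 2 \<le> n) \<and> (z \<longrightarrow> 1 \<le> n)"

text \<open>
  The neighbours of the new vertex must come from different trees. The last condition concerns
  \<open>n - 2\<close>, which leaves the frontier: its tree must reach \<open>n - 1\<close> or \<open>n\<close>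
  already, or else it must be joined to \<open>n + 1\<close>.
\<close>

fun admissible :: "nat \<Rightarrow> bool \<times> bool \<times> bool \<Rightarrow> bool \<times> bool \<times> bool \<Rightarrow> bool" where
  "admissible n (p, q, r) (x, y, z) \<longleftrightarrow>
     \<not> (x \<and> y \<and> p) \<and> \<not> (x \<and> z \<and> q) \<and> \<not> (y \<and> z \<and> r) \<and> (3 \<le> n \<longrightarrow> x \<or> p \<or> q)"

text \<open>
  The second and third components say that \<open>n - 1\<close> and \<open>n\<close>, respectively, become connected
  to \<open>n + 1\<close>. The vertices \<open>n - 1\<close> and \<open>n\<close> lie in the same new tree if they did before or
  if both are connected to \<open>n + 1\<close>.
\<close>

fun next_state :: "bool \<times> bool \<times> bool \<Rightarrow> bool \<times> bool \<times> bool \<Rightarrow> bool \<times> bool \<times> bool" where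
  "next_state (p, q, r) (x, y, z) =
     (r \<or> (x \<and> p \<or> y \<or> z \<and> r) \<and> (x \<and> q \<or> y \<and> r \<or> z),
      x \<and> p \<or> y \<or> z \<and> r, x \<and> q \<or> y \<and> r \<or> z)"

lemma forest_rel_imp_sym: "forest_rel A \<Longrightarrow> sym A"
  by (simp add: forest_rel_def)

lemma nbrs_subset: "present n \<xi> \<Longrightarrow> nbrs n \<xi> \<subseteq> {n - 2..n} - {0}"
  by (cases \<xi>) auto

lemma nbrs_inject: "nbrs n \<xi> = nbrs n \<xi>' \<Longrightarrow> present n \<xi> \<Longrightarrow> present n \<xi>' \<Longrightarrow> \<xi> = \<xi>'"
proof -
  assume eq: "nbrs n \<xi> = nbrs n \<xi>'" and ex: "present n \<xi>" "present n \<xi>'"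
  have "\<xi> = (3 \<le> n \<and> n - 2 \<in> nbrs n \<xi>, 2 \<le> n \<and> n - 1 \<in> nbrs n \<xi>, 1 \<le> n \<and> n \<in> nbrs n \<xi>)"
    if "present n \<xi>" for \<xi>
    using that by (cases \<xi>) auto
  from this[OF ex(1)] this[OF ex(2)] eq show "\<xi> = \<xi>'" by simp
qed

lemma attach_subset:
  assumes "A \<subseteq> parcs (graph_power (path_graph n) 3)" "present n \<xi>"
  shows "A \<union> star (Suc n) (nbrs n \<xi>) \<subseteq> parcs (graph_power (path_graph (Suc n)) 3)"
  using assms(1) nbrs_subset[OF assms(2)]
  by (fastforce simp: parcs_path_graph_power star_def)

text \<open>
  Whether the enlarged forest qualifies, and in which state it is, depends on the old forest only
  through its state. This is what turns counting into a linear recurrence on finitely many numbers.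
\<close>

lemma frontier_forests_attach_iff:
  assumes A: "A \<subseteq> parcs (graph_power (path_graph n) 3)" "sym A" and ex: "present n \<xi>"
  shows "A \<union> star (Suc n) (nbrs n \<xi>) \<in> frontier_forests (Suc n) \<tau> \<longleftrightarrow>
    (\<exists>\<sigma>. A \<in> frontier_forests n \<sigma> \<and> admissible n \<sigma> \<xi> \<and> next_state \<sigma> \<xi> = \<tau>)"
proof -
  let ?w = "Suc n" and ?S = "nbrs n \<xi>"
  let ?B = "A \<union> star ?w ?S"
  obtain x y z where \<xi>: "\<xi> = (x, y, z)" by (cases \<xi>)
  define p q r where "p \<longleftrightarrow> (n - 2, n - 1) \<in> A\<^sup>*" and "q \<longleftrightarrow> (n - 2, n) \<in> A\<^sup>*"
    and "r \<longleftrightarrow> (n - 1, n) \<in> A\<^sup>*"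
  note pqr = p_def[symmetric] q_def[symmetric] r_def[symmetric]
  have com: "(n - 1, n - 2) \<in> A\<^sup>* \<longleftrightarrow> p" "(n, n - 2) \<in> A\<^sup>* \<longleftrightarrow> q" "(n, n - 1) \<in> A\<^sup>* \<longleftrightarrow> r"
    unfolding p_def q_def r_def using rtrancl_commute[OF A(2)] by blast+
  have w: "?w \<notin> Field A" "?w \<notin> ?S"
    using A(1) nbrs_subset[OF ex] by (auto simp: Field_def parcs_path_graph_power)
  \<comment> \<open>\<open>h v\<close>: the tree of \<open>v\<close> gets joined to the new vertex\<close>
  define h where "h v \<longleftrightarrow> x \<and> (v, n - 2) \<in> A\<^sup>* \<or> y \<and> (v, n - 1) \<in> A\<^sup>* \<or> z \<and> (v, n) \<in> A\<^sup>*" for v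
  have h: "(\<exists>s\<in>?S. (v, s) \<in> A\<^sup>*) \<longleftrightarrow> h v" for v
    unfolding h_def \<xi> by auto
  have h': "(\<exists>s\<in>?S. (s, v) \<in> A\<^sup>*) \<longleftrightarrow> h v" for v
    using h[of v] rtrancl_commute[OF A(2)] by blast
  have to_w: "(v, ?w) \<in> ?B\<^sup>* \<longleftrightarrow> h v" if "v \<noteq> ?w" for v
    using rtrancl_star_hub(1)[OF w that] h by simp
  have to_old: "(v, u) \<in> ?B\<^sup>* \<longleftrightarrow> (v, u) \<in> A\<^sup>* \<or> h v \<and> h u" if "v \<noteq> ?w" "u \<noteq> ?w" for u v
    using rtrancl_star_hub(2)[OF w that] h h' by simp
  have h_frontier: "h (n - 2) \<longleftrightarrow> x \<or> y \<and> p \<or> z \<and> q" "h (n - 1) \<longleftrightarrow> x \<and> p \<or> y \<or> z \<and> r"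
    "h n \<longleftrightarrow> x \<and> q \<or> y \<and> r \<or> z"
    unfolding h_def by (auto simp: com pqr simp del: One_nat_def)
  have state: "((Suc n - 2, Suc n - 1) \<in> ?B\<^sup>*, (Suc n - 2, Suc n) \<in> ?B\<^sup>*, (Suc n - 1, Suc n) \<in> ?B\<^sup>*)
      = next_state (p, q, r) \<xi>"
  proof -
    have "Suc n - 2 = n - 1" "Suc n - 1 = n" "n - 1 \<noteq> Suc n" by auto
    moreover have "next_state (p, q, r) \<xi> = (r \<or> h (n - 1) \<and> h n, h (n - 1), h n)"
      unfolding h_frontier \<xi> by simp
    ultimately show ?thesis by (simp add: to_w to_old pqr del: One_nat_def)
  qed
  have indep: "(\<forall>s\<in>?S. \<forall>s'\<in>?S. (s, s') \<in> A\<^sup>* \<longrightarrow> s = s') \<longleftrightarrow>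
      \<not> (x \<and> y \<and> p) \<and> \<not> (x \<and> z \<and> q) \<and> \<not> (y \<and> z \<and> r)"
  proof -
    have "x \<longrightarrow> n - 2 \<noteq> n - 1 \<and> n - 2 \<noteq> n" "y \<longrightarrow> n - 1 \<noteq> n"
      using ex by (auto simp: \<xi>)
    then show ?thesis unfolding \<xi> by (auto simp: com pqr simp del: One_nat_def)
  qed
  have mem_frontier: "(\<exists>f\<in>{n - 2..n}. P f) \<longleftrightarrow> P (n - 2) \<or> P (n - 1) \<or> P n"
    "(\<exists>f\<in>{n - 1..Suc n}. P f) \<longleftrightarrow> P (n - 1) \<or> P n \<or> P (Suc n)" for P
  proof -
    have "{n - 2..n} = {n - 2, n - 1, n}" "{n - 1..Suc n} = {n - 1, n, Suc n}" by auto
    then show "(\<exists>f\<in>{n - 2..n}. P f) \<longleftrightarrow> P (n - 2) \<or> P (n - 1) \<or> P n"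
      "(\<exists>f\<in>{n - 1..Suc n}. P f) \<longleftrightarrow> P (n - 1) \<or> P n \<or> P (Suc n)" by auto
  qed
  \<comment> \<open>a tree that met the old frontier only in \<open>n - 2\<close> must be joined to the new vertex; for
    \<open>n < 3\<close> no vertex leaves the frontier\<close>
  have touch: "(\<forall>v\<in>{1..Suc n}. \<exists>f\<in>{Suc n - 2..Suc n}. (v, f) \<in> ?B\<^sup>*) \<longleftrightarrow>
      (\<forall>v\<in>{1..n}. \<exists>f\<in>{n - 2..n}. (v, f) \<in> A\<^sup>*) \<and> (3 \<le> n \<longrightarrow> x \<or> p \<or> q)" (is "?L \<longleftrightarrow> ?R")
  proof -
    have new: "(\<exists>f\<in>{Suc n - 2..Suc n}. (v, f) \<in> ?B\<^sup>*) \<longleftrightarrow>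
        (v, n - 1) \<in> A\<^sup>* \<or> (v, n) \<in> A\<^sup>* \<or> h v" if "v \<in> {1..n}" for v
    proof -
      have *: "v \<noteq> Suc n" "Suc n - 2 = n - 1" "n - 1 \<noteq> Suc n" using that by auto
      show ?thesis
        unfolding *(2) mem_frontier using * by (auto simp: to_w to_old)
    qed
    have "?L \<longleftrightarrow> (\<forall>v\<in>{1..n}. \<exists>f\<in>{Suc n - 2..Suc n}. (v, f) \<in> ?B\<^sup>*)"
      by (auto simp: atLeastAtMostSuc_conv)
    also have "\<dots> \<longleftrightarrow> (\<forall>v\<in>{1..n}. (v, n - 1) \<in> A\<^sup>* \<or> (v, n) \<in> A\<^sup>* \<or> h v)"
      using new by blast
    also have "\<dots> \<longleftrightarrow> ?R"
    proof (cases "3 \<le> n")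
      case True
      then have a: "n - 2 \<in> {1..n}" by auto
      have "(v, n - 2) \<in> A\<^sup>* \<longrightarrow> (v, n - 1) \<in> A\<^sup>* \<or> (v, n) \<in> A\<^sup>* \<or> h v" if "x \<or> p \<or> q" for v
        using that unfolding p_def q_def h_def by (meson rtrancl_trans)
      moreover have "h v \<longrightarrow> (\<exists>f\<in>{n - 2..n}. (v, f) \<in> A\<^sup>*)" for v
        unfolding mem_frontier h_def by blast
      moreover have "(n - 2, n - 1) \<in> A\<^sup>* \<or> (n - 2, n) \<in> A\<^sup>* \<or> h (n - 2) \<longleftrightarrow> x \<or> p \<or> q"
        by (auto simp: pqr h_frontier simp del: One_nat_def)
      ultimately show ?thesis using a True unfolding mem_frontier by blast
    next
      case False
      then have "v = n - 1 \<or> v = n" if "v \<in> {1..n}" for v using that by auto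
      then show ?thesis using False unfolding mem_frontier by blast
    qed
    finally show ?thesis .
  qed
  show ?thesis
    unfolding frontier_forests_def mem_Collect_eq state touch
      forest_rel_star_iff[OF A(2) w] indep
    using A(1) attach_subset[OF A(1) ex] by (auto simp: \<xi> pqr simp del: One_nat_def)
qed

text \<open>
  Deleting the largest vertex inverts the attachment.
\<close>

lemma ex_attach:
  assumes "B \<in> frontier_forests (Suc n) \<tau>"
  obtains A \<xi> where "A \<subseteq> parcs (graph_power (path_graph n) 3)" "sym A" "present n \<xi>"
    "B = A \<union> star (Suc n) (nbrs n \<xi>)"
proof -
  let ?E = "\<lambda>n. parcs (graph_power (path_graph n) 3)"
  have B: "B \<subseteq> ?E (Suc n)" "sym B"
    using assms by (auto simp: frontier_forests_def forest_rel_def)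
  let ?S = "B `` {Suc n}"
  let ?\<xi> = "(3 \<le> n \<and> n - 2 \<in> ?S, 2 \<le> n \<and> n - 1 \<in> ?S, 1 \<le> n \<and> n \<in> ?S)"
  have S: "?S \<subseteq> {n - 2..n} - {0}"
    using B(1) by (auto simp: parcs_path_graph_power)
  have "?S \<subseteq> nbrs n ?\<xi>"
  proof
    fix v assume v: "v \<in> ?S"
    with S have "v \<in> {n - 2..n} - {0}" by blast
    then have "v = n - 2 \<or> v = n - 1 \<or> v = n" "v \<noteq> 0" by auto
    with v show "v \<in> nbrs n ?\<xi>" by auto
  qed
  then have nb: "nbrs n ?\<xi> = ?S" by auto
  have split: "B = (B \<inter> ?E n) \<union> star (Suc n) ?S"
  proof
    show "B \<subseteq> (B \<inter> ?E n) \<union> star (Suc n) ?S"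
    proof (rule subrelI)
      fix u v assume uv: "(u, v) \<in> B"
      then have "(v, u) \<in> B" using B(2) by (auto dest: symD)
      with uv B(1) show "(u, v) \<in> (B \<inter> ?E n) \<union> star (Suc n) ?S"
        by (auto simp: star_def parcs_path_graph_power le_Suc_eq)
    qed
    show "(B \<inter> ?E n) \<union> star (Suc n) ?S \<subseteq> B"
      using B(2) by (auto simp: star_def dest: symD)
  qed
  show thesis
  proof (rule that)
    show "B = (B \<inter> ?E n) \<union> star (Suc n) (nbrs n ?\<xi>)"
      unfolding nb by (rule split)
    show "sym (B \<inter> ?E n)"
      using B(2) by (auto simp: sym_def parcs_path_graph_power)
  qed auto
qed

lemma finite_frontier_forests: "finite (frontier_forests n \<sigma>)"
proof (rule finite_subset)
  show "frontier_forests n \<sigma> \<subseteq> Pow ({1..n} \<times> {1..n})"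
    by (auto simp: frontier_forests_def parcs_path_graph_power)
qed simp

text \<open>
  The pair of old forest and neighbourhood can be read off the enlarged forest, so attaching is a
  bijection and the numbers of forests add up over all transitions into \<open>\<tau>\<close>.
\<close>

lemma card_frontier_forests_Suc:
  "card (frontier_forests (Suc n) \<tau>) =
    (\<Sum>(\<sigma>, \<xi>)\<in>UNIV. if present n \<xi> \<and> admissible n \<sigma> \<xi> \<and> next_state \<sigma> \<xi> = \<tau>
      then card (frontier_forests n \<sigma>) else 0)"
proof -
  define I where "I = {(\<sigma>, \<xi>). present n \<xi> \<and> admissible n \<sigma> \<xi> \<and> next_state \<sigma> \<xi> = \<tau>}"
  let ?X = "SIGMA i:I. frontier_forests n (fst i)"
  let ?f = "\<lambda>(i, A). A \<union> star (Suc n) (nbrs n (snd i))"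
  have image: "frontier_forests (Suc n) \<tau> = ?f ` ?X"
  proof
    show "frontier_forests (Suc n) \<tau> \<subseteq> ?f ` ?X"
    proof
      fix B assume B: "B \<in> frontier_forests (Suc n) \<tau>"
      then obtain A \<xi> where A: "A \<subseteq> parcs (graph_power (path_graph n) 3)" "sym A" "present n \<xi>"
        "B = A \<union> star (Suc n) (nbrs n \<xi>)" by (rule ex_attach)
      with B obtain \<sigma> where "A \<in> frontier_forests n \<sigma>" "admissible n \<sigma> \<xi>" "next_state \<sigma> \<xi> = \<tau>"
        using frontier_forests_attach_iff[OF A(1-3)] by blast
      with A show "B \<in> ?f ` ?X"
        by (intro image_eqI[of _ _ "((\<sigma>, \<xi>), A)"]) (auto simp: I_def)
    qed
    show "?f ` ?X \<subseteq> frontier_forests (Suc n) \<tau>"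
    proof
      fix B assume "B \<in> ?f ` ?X"
      then obtain \<sigma> \<xi> A where A: "A \<in> frontier_forests n \<sigma>" "present n \<xi>" "admissible n \<sigma> \<xi>"
        "next_state \<sigma> \<xi> = \<tau>" "B = A \<union> star (Suc n) (nbrs n \<xi>)"
        by (auto simp: I_def)
      have "A \<subseteq> parcs (graph_power (path_graph n) 3)" "sym A"
        using A(1) by (auto simp: frontier_forests_def forest_rel_def)
      with A show "B \<in> frontier_forests (Suc n) \<tau>"
        using frontier_forests_attach_iff[of A n \<xi> \<tau>] by blast
    qed
  qed
  have inj: "inj_on ?f ?X"
  proof (rule inj_onI)
    fix a b assume ab: "a \<in> ?X" "b \<in> ?X" "?f a = ?f b"
    obtain \<sigma> \<xi> A \<sigma>' \<xi>' A' where [simp]: "a = ((\<sigma>, \<xi>), A)" "b = ((\<sigma>', \<xi>'), A')"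
      by (metis prod.collapse)
    have A: "A \<in> frontier_forests n \<sigma>" "present n \<xi>" "A' \<in> frontier_forests n \<sigma>'" "present n \<xi>'"
      using ab(1,2) by (auto simp: I_def)
    have eq: "A \<union> star (Suc n) (nbrs n \<xi>) = A' \<union> star (Suc n) (nbrs n \<xi>')"
      using ab(3) by simp
    have old: "A \<subseteq> {1..n} \<times> {1..n}" "A' \<subseteq> {1..n} \<times> {1..n}"
      using A by (auto simp: frontier_forests_def parcs_path_graph_power)
    then have "nbrs n \<xi> = (A \<union> star (Suc n) (nbrs n \<xi>)) `` {Suc n}"
      "nbrs n \<xi>' = (A' \<union> star (Suc n) (nbrs n \<xi>')) `` {Suc n}"
      using nbrs_subset[OF A(2)] nbrs_subset[OF A(4)] by (auto simp: star_def)
    with eq have nb: "nbrs n \<xi> = nbrs n \<xi>'" by simp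
    have "A = (A \<union> star (Suc n) (nbrs n \<xi>)) \<inter> {1..n} \<times> {1..n}"
      "A' = (A' \<union> star (Suc n) (nbrs n \<xi>')) \<inter> {1..n} \<times> {1..n}"
      using old by (auto simp: star_def)
    with eq have "A = A'" by simp
    moreover from this have "\<sigma> = \<sigma>'" using A(1,3) by (simp add: frontier_forests_def)
    moreover have "\<xi> = \<xi>'" using nb A(2,4) by (rule nbrs_inject)
    ultimately show "a = b" by simp
  qed
  have "card (frontier_forests (Suc n) \<tau>) = card ?X"
    unfolding image using inj by (rule card_image)
  also have "\<dots> = (\<Sum>i\<in>I. card (frontier_forests n (fst i)))"
    by (intro card_SigmaI) (auto simp: finite_frontier_forests)
  also have "\<dots> = (\<Sum>i\<in>UNIV. if i \<in> I then card (frontier_forests n (fst i)) else 0)"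
    by (simp add: sum.If_cases)
  finally show ?thesis by (simp add: I_def case_prod_unfold)
qed

section \<open>The linear recurrence\<close>

lemma frontier_forests_0: "frontier_forests 0 \<sigma> = (if \<sigma> = (True, True, True) then {{}} else {})"
  by (auto simp: frontier_forests_def parcs_path_graph_power forest_rel_def)

text \<open>
  Three of the eight triples do not describe a partition of the frontier; the five others do.
\<close>

lemma frontier_forests_intransitive:
  "frontier_forests n (True, True, False) = {}"
  "frontier_forests n (True, False, True) = {}"
  "frontier_forests n (False, True, True) = {}"
proof -
  have "(q \<and> p \<longrightarrow> r) \<and> (q \<and> r \<longrightarrow> p) \<and> (p \<and> r \<longrightarrow> q)" if A: "A \<in> frontier_forests n (p, q, r)" for p q r A
  proof -
    have "sym A" using A by (auto simp: frontier_forests_def forest_rel_def)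
    note com = rtrancl_commute[OF this]
    show ?thesis
      using A com by (simp add: frontier_forests_def) (meson rtrancl_trans)
  qed
  then show "frontier_forests n (True, True, False) = {}"
    "frontier_forests n (True, False, True) = {}"
    "frontier_forests n (False, True, True) = {}" by fast+
qed

lemma sum_UNIV_prod:
  fixes g :: "'a::finite \<times> 'b::finite \<Rightarrow> 'c::comm_monoid_add"
  shows "(\<Sum>i\<in>UNIV. g i) = (\<Sum>a\<in>UNIV. \<Sum>b\<in>UNIV. g (a, b))"
  by (simp add: sum.cartesian_product)

lemmas card_frontier_forests_Suc_expanded = card_frontier_forests_Suc[unfolded sum_UNIV_prod prod.case]

lemma card_frontier_forests_3:
  "card (frontier_forests 3 (True, True, True)) = 3"
  "card (frontier_forests 3 (True, False, False)) = 1"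
  "card (frontier_forests 3 (False, True, False)) = 1"
  "card (frontier_forests 3 (False, False, True)) = 1"
  "card (frontier_forests 3 (False, False, False)) = 1"
  by (simp_all add: numeral_3_eq_3 card_frontier_forests_Suc_expanded UNIV_bool
      frontier_forests_intransitive frontier_forests_0)

text \<open>
  From \<open>n = 3\<close> on all three frontier vertices exist, and the transition matrix is constant.
\<close>

lemma card_frontier_forests_rec:
  fixes n
  defines "c \<equiv> \<lambda>m p q r. card (frontier_forests m (p, q, r))"
  assumes "3 \<le> n"
  shows "c (Suc n) True True True = 3 * c n True True True + 2 * c n True False False
      + 2 * c n False True False + 2 * c n False False True + c n False False False"
    and "c (Suc n) True False False = c n True True True + c n False False True"
    and "c (Suc n) False True False =
      2 * c n True False False + c n False True False + c n False False False"
    and "c (Suc n) False False True =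
      c n True False False + 2 * c n False True False + c n False False False"
    and "c (Suc n) False False False =
      c n True False False + c n False True False + c n False False False"
  using \<open>3 \<le> n\<close> unfolding c_def
  by (simp_all add: card_frontier_forests_Suc_expanded UNIV_bool frontier_forests_intransitive)

text \<open>
  The coefficients are those of the characteristic polynomial
  \<open>t^5 - 5 t^4 + 3 t^3 - 3 t^2 + 5 t - 1\<close> of the transition matrix above.
\<close>

lemma card_frontier_forests_connected_rec:
  fixes n
  defines "t \<equiv> \<lambda>m. int (card (frontier_forests m (True, True, True)))"
  assumes "3 \<le> n"
  shows "t (n + 5) = 5 * t (n + 4) - 3 * t (n + 3) + 3 * t (n + 2) - 5 * t (n + 1) + t n"
proof -
  have n: "n + 1 = Suc n" "n + 2 = Suc (Suc n)" "n + 3 = Suc (Suc (Suc n))"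
    "n + 4 = Suc (Suc (Suc (Suc n)))" "n + 5 = Suc (Suc (Suc (Suc (Suc n))))" by simp_all
  show ?thesis
    unfolding t_def n using \<open>3 \<le> n\<close> by (simp add: card_frontier_forests_rec)
qed

section \<open>Spanning trees and the generating function\<close>

text \<open>
  If every vertex is connected to the frontier and the frontier lies in one tree, that tree is all
  of the forest.
\<close>

lemma num_spanning_trees_eq_card:
  assumes "3 \<le> n"
  shows "num_spanning_trees (graph_power (path_graph n) 3) =
    card (frontier_forests n (True, True, True))"
proof -
  let ?G = "graph_power (path_graph n) 3"
  have verts: "pverts ?G = {1..n}" by (simp add: graph_power_def)
  have finE: "finite (parcs ?G)"
    by (rule finite_subset[of _ "{1..n} \<times> {1..n}"]) (auto simp: parcs_path_graph_power)
  have pg: "pair_graph \<lparr>pverts = {1..n}, parcs = A\<rparr>" if "A \<subseteq> parcs ?G" "sym A" for A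
    using that finite_subset[OF that(1) finE]
    by unfold_locales (auto simp: parcs_path_graph_power symmetric_def)
  have wfG: "wf_digraph (with_proj ?G)"
    by unfold_locales (auto simp: verts parcs_path_graph_power)
  have conn: "(\<forall>u\<in>{1..n}. \<forall>v\<in>{1..n}. (u, v) \<in> A\<^sup>*) \<longleftrightarrow>
      (\<forall>v\<in>{1..n}. \<exists>f\<in>{n - 2..n}. (v, f) \<in> A\<^sup>*) \<and>
      (n - 2, n - 1) \<in> A\<^sup>* \<and> (n - 2, n) \<in> A\<^sup>* \<and> (n - 1, n) \<in> A\<^sup>*" (is "?L \<longleftrightarrow> ?R") if "sym A" for A
  proof
    assume ?L
    moreover have "n - 2 \<in> {1..n}" "n - 1 \<in> {1..n}" "n \<in> {1..n}" using assms by auto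
    moreover have "n \<in> {n - 2..n}" by simp
    ultimately show ?R by blast
  next
    assume R: ?R
    have "(v, n) \<in> A\<^sup>*" if "v \<in> {1..n}" for v
    proof -
      from R that obtain f where f: "f \<in> {n - 2..n}" "(v, f) \<in> A\<^sup>*" by blast
      then have "f = n - 2 \<or> f = n - 1 \<or> f = n" by auto
      with R have "(f, n) \<in> A\<^sup>*" by auto
      with f show ?thesis by (meson rtrancl_trans)
    qed
    then show ?L using rtrancl_commute[OF that] by (meson rtrancl_trans)
  qed
  have "spanning_trees ?G = (\<lambda>A. \<lparr>pverts = {1..n}, parcs = A\<rparr>) ` frontier_forests n (True, True, True)"
  proof
    show "spanning_trees ?G \<subseteq> (\<lambda>A. \<lparr>pverts = {1..n}, parcs = A\<rparr>) ` frontier_forests n (True, True, True)"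
    proof
      fix T assume "T \<in> spanning_trees ?G"
      then have T: "undirected_tree T" "pverts T = {1..n}" "parcs T \<subseteq> parcs ?G"
        by (auto simp: spanning_trees_def spanning_def subgraph_def verts)
      interpret pair_graph T using T(1) by (simp add: undirected_tree_def)
      from T(1,2) have A: "\<forall>u\<in>{1..n}. \<forall>v\<in>{1..n}. (u, v) \<in> (parcs T)\<^sup>*" "forest_rel (parcs T)"
        by (auto simp: undirected_tree_iff)
      have "parcs T \<in> frontier_forests n (True, True, True)"
        using A T(3) conn[OF forest_rel_imp_sym[OF A(2)]] by (simp add: frontier_forests_def)
      with T(2) show "T \<in> (\<lambda>A. \<lparr>pverts = {1..n}, parcs = A\<rparr>) ` frontier_forests n (True, True, True)"
        by (intro image_eqI[of _ _ "parcs T"]) auto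
    qed
    show "(\<lambda>A. \<lparr>pverts = {1..n}, parcs = A\<rparr>) ` frontier_forests n (True, True, True) \<subseteq> spanning_trees ?G"
    proof (rule image_subsetI)
      fix A assume A: "A \<in> frontier_forests n (True, True, True)"
      let ?T = "\<lparr>pverts = {1..n}, parcs = A\<rparr>"
      have sub: "A \<subseteq> parcs ?G" and forest: "forest_rel A" using A by (auto simp: frontier_forests_def)
      note sym = forest_rel_imp_sym[OF forest]
      interpret T: pair_graph ?T using pg[OF sub sym] .
      have "\<forall>u\<in>{1..n}. \<forall>v\<in>{1..n}. (u, v) \<in> A\<^sup>*"
        using A conn[OF sym] by (simp add: frontier_forests_def)
      then have "undirected_tree ?T"
        unfolding T.undirected_tree_iff using forest assms by simp
      moreover have "spanning (with_proj ?T) (with_proj ?G)"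
        using sub wfG T.wf_digraph_axioms
        by (simp add: spanning_def subgraph_def compatible_def verts)
      ultimately show "?T \<in> spanning_trees ?G" by (simp add: spanning_trees_def)
    qed
  qed
  then show ?thesis
    unfolding num_spanning_trees_def by (simp add: card_image inj_on_def)
qed

theorem theorem6p1p2:
  shows "Abs_fps (\<lambda>m. of_nat (num_spanning_trees (graph_power (path_graph (m + 5)) 3)) :: rat) =
    (- 16 * fps_X ^ 4 + 77 * fps_X ^ 3 - 33 * fps_X ^ 2 + 39 * fps_X - 75) /
    ((fps_X - 1) * (fps_X ^ 4 - 4 * fps_X ^ 3 - fps_X ^ 2 - 4 * fps_X + 1))"
    (is "?F = ?N / ?D")
proof -
  define f :: "nat \<Rightarrow> rat" where "f m = of_nat (num_spanning_trees (graph_power (path_graph (m + 5)) 3))" for m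
  define t where "t m = card (frontier_forests m (True, True, True))" for m
  have f_t: "f m = of_nat (t (m + 5))" for m
    by (simp add: f_def t_def num_spanning_trees_eq_card)
  have rec: "f (m + 5) = 5 * f (m + 4) - 3 * f (m + 3) + 3 * f (m + 2) - 5 * f (m + 1) + f m" for m
  proof -
    have "int (t (m + 10)) = 5 * int (t (m + 9)) - 3 * int (t (m + 8)) + 3 * int (t (m + 7))
        - 5 * int (t (m + 6)) + int (t (m + 5))"
      using card_frontier_forests_connected_rec[of "m + 5"] by (simp add: t_def add.commute)
    then have "rat_of_int (int (t (m + 10))) = rat_of_int (5 * int (t (m + 9)) - 3 * int (t (m + 8))
        + 3 * int (t (m + 7)) - 5 * int (t (m + 6)) + int (t (m + 5)))" by simp
    then show ?thesis unfolding f_t by (simp add: add.commute)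
  qed
  have init: "f 0 = 75" "f 1 = 336" "f 2 = 1488" "f 3 = 6580" "f 4 = 29085"
  proof -
    have "Suc 3 = 4" "Suc 4 = 5" "Suc 5 = 6" "Suc 6 = 7" "Suc 7 = 8" "Suc 8 = 9" by simp_all
    note S = this
    note rec = card_frontier_forests_rec[of 3, unfolded S card_frontier_forests_3, simplified]
    note rec = rec card_frontier_forests_rec[of 4, unfolded S rec, simplified]
    note rec = rec card_frontier_forests_rec[of 5, unfolded S rec, simplified]
    note rec = rec card_frontier_forests_rec[of 6, unfolded S rec, simplified]
    note rec = rec card_frontier_forests_rec[of 7, unfolded S rec, simplified]
    note rec = rec card_frontier_forests_rec[of 8, unfolded S rec, simplified]
    show "f 0 = 75" "f 1 = 336" "f 2 = 1488" "f 3 = 6580" "f 4 = 29085"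
      by (simp_all add: f_t t_def rec)
  qed
  \<comment> \<open>reversing the coefficients of the characteristic polynomial only changes its sign,
    hence the denominator is that same polynomial\<close>
  have D: "?D = fps_X ^ 5 - 5 * fps_X ^ 4 + 3 * fps_X ^ 3 - 3 * fps_X ^ 2 + 5 * fps_X - (1 :: rat fps)"
    by (simp add: algebra_simps power_numeral_reduce)
  let ?c = "fps_const :: rat \<Rightarrow> rat fps"
  \<comment> \<open>the recurrence annihilates all coefficients from index 5 on; the first five values give the
    numerator\<close>
  have "Abs_fps f * fps_X ^ 5 - ?c 5 * (Abs_fps f * fps_X ^ 4) + ?c 3 * (Abs_fps f * fps_X ^ 3)
      - ?c 3 * (Abs_fps f * fps_X ^ 2) + ?c 5 * (Abs_fps f * fps_X) - Abs_fps f =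
      - ?c 16 * fps_X ^ 4 + ?c 77 * fps_X ^ 3 - ?c 33 * fps_X ^ 2 + ?c 39 * fps_X - ?c 75"
    (is "?l = ?r")
  proof (rule fps_ext)
    fix n :: nat
    have "n = 0 \<or> n = 1 \<or> n = 2 \<or> n = 3 \<or> n = 4 \<or> (\<exists>m. n = m + 5)" by presburger
    then show "fps_nth ?l n = fps_nth ?r n"
      using init rec by (auto simp: fps_X_power_mult_right_nth fps_X_power_nth add.commute)
  qed
  then have "Abs_fps f * ?D = ?N"
    unfolding D numeral_fps_const[symmetric] by (simp add: algebra_simps)
  moreover have "?D \<noteq> 0"
  proof
    assume "?D = 0"
    then have "fps_nth ?D 0 = 0" by simp
    then show False by simp
  qed
  ultimately have "Abs_fps f = ?N / ?D"
    by (metis nonzero_mult_div_cancel_right)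
  then show ?thesis unfolding f_def .
qed

end
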